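(* Let $R$ be a ring and let $\Gamma'(R)$ be the unity product graph associated with $R$. Then $\Gamma'(R)$ is an empty graph if $R$ is isomorphic to any of the following rings: (1) $R\cong S$, where $S$ is a reduced ring with $\mathrm{Char}(S)=0$ and $|U(S)|=2$; (2) $R\cong\mathbb{Z}_n$, where $n>1$ is a divisor of $24$.
   Context: Rings here have a unity $e$. $\mathbb{Z}_n$ is the ring of integers modulo $n$, and $\mathrm{Char}$ denotes the characteristic. $U(R)$ denotes the set of units of $R$. The unity product graph $\Gamma'(R)$ is the simple graph with vertex set $U(R)$ in which two distinct vertices $r_i,r_j$ are adjacent if and only if $r_i\cdot r_j=e$. A graph is called empty if it contains no edges (it may have vertices). *)

theory Defs
  imports "HOL-Algebra.Algebra" "HOL-Number_Theory.Residues"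
begin

definition reduced_ring :: "('a, 'm) ring_scheme \<Rightarrow> bool" where
  "reduced_ring R \<longleftrightarrow> ring R \<and>
     (\<forall>x \<in> carrier R. \<forall>k::nat. k > 0 \<longrightarrow> x [^]\<^bsub>R\<^esub> k = \<zero>\<^bsub>R\<^esub> \<longrightarrow> x = \<zero>\<^bsub>R\<^esub>)"

definition ring_char :: "('a, 'm) ring_scheme \<Rightarrow> nat" where
  "ring_char R =
     (if \<exists>k::nat. k > 0 \<and> (\<forall>x \<in> carrier R. [k] \<cdot>\<^bsub>R\<^esub> x = \<zero>\<^bsub>R\<^esub>)
      then LEAST k::nat. k > 0 \<and> (\<forall>x \<in> carrier R. [k] \<cdot>\<^bsub>R\<^esub> x = \<zero>\<^bsub>R\<^esub>)
      else 0)"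

text \<open>Simple graphs, possibly infinite (unit groups need not be finite): every edge is a set of
  two distinct vertices.\<close>

record 'a simple_graph =
  vertices :: "'a set"
  edges :: "'a set set"

definition is_simple_graph :: "('a, 'm) simple_graph_scheme \<Rightarrow> bool" where
  "is_simple_graph G \<longleftrightarrow> (\<forall>d \<in> edges G. d \<subseteq> vertices G \<and> card d = 2)"

definition empty_graph :: "('a, 'm) simple_graph_scheme \<Rightarrow> bool" where
  "empty_graph G \<longleftrightarrow> is_simple_graph G \<and> edges G = {}"

definition unity_product_graph :: "('a, 'm) ring_scheme \<Rightarrow> 'a simple_graph" where
  "unity_product_graph R =
     \<lparr>vertices = Units R,
      edges = {{r, s} | r s. r \<in> Units R \<and> s \<in> Units R \<and> r \<noteq> s \<and> r \<otimes>\<^bsub>R\<^esub> s = \<one>\<^bsub>R\<^esub>}\<rparr>"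

lemma is_simple_graph_unity_product_graph: "is_simple_graph (unity_product_graph R)"
  by (auto simp: is_simple_graph_def unity_product_graph_def)

text \<open>Even when \<^term>\<open>R\<close> is not commutative, adjacency is symmetric: if the product of two units is
  the unity, so is the product in the other order.\<close>

lemma adjacent_unity_product_graph_iff:
  fixes R (structure)
  assumes "ring R"
  shows "{r, s} \<in> edges (unity_product_graph R) \<longleftrightarrow>
    r \<in> Units R \<and> s \<in> Units R \<and> r \<noteq> s \<and> r \<otimes> s = \<one>"
proof -
  interpret ring R by fact
  have "s \<otimes> r = \<one>" if "r \<in> Units R" "s \<in> Units R" "r \<otimes> s = \<one>" for r s
    using that by (metis Units_closed Units_inv_comm)
  then show ?thesis
    by (auto simp: unity_product_graph_def doubleton_eq_iff)
qed

end

theory Submission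
  imports Defs
begin

text \<open>An edge of the unity product graph joins a unit to its inverse, provided the two differ. The
  graph is therefore empty as soon as every unit is its own inverse, that is, as soon as the unit
  group has exponent dividing \<open>2\<close> (\<open>empty_unity_product_graph\<close>). This property is invariant
  under ring isomorphism (\<open>units_square_one_iso\<close>), so it only has to be checked on the two model
  rings. A unit group of order \<open>2\<close> has it by Lagrange's theorem. For \<open>\<int>\<^sub>n\<close> with \<open>n\<close> dividing
  \<open>24 = 8 \<sqdot> 3\<close> it comes from the fact that odd squares are \<open>1\<close> modulo \<open>8\<close> and squares prime to
  \<open>3\<close> are \<open>1\<close> modulo \<open>3\<close> (\<open>dvd_square_minus_one\<close>).\<close>

lemma empty_unity_product_graph:
  fixes R (structure)
  assumes "ring R" and sq: "\<And>u. u \<in> Units R \<Longrightarrow> u \<otimes> u = \<one>"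
  shows "empty_graph (unity_product_graph R)"
proof -
  interpret ring R by fact
  have "r = s" if "r \<in> Units R" "s \<in> Units R" "r \<otimes> s = \<one>" for r s
  proof -
    have "r \<otimes> r = r \<otimes> s" using that(1,3) sq by simp
    then show ?thesis
      using Units_l_cancel[OF that(1) Units_closed[OF that(1)] Units_closed[OF that(2)]] by blast
  qed
  then have "edges (unity_product_graph R) = {}"
    unfolding unity_product_graph_def simple_graph.simps by blast
  then show ?thesis
    by (simp add: empty_graph_def is_simple_graph_unity_product_graph)
qed

lemma units_square_one_iso:
  assumes "ring R" "ring S" "R \<simeq> S"
    and sq: "\<And>v. v \<in> Units S \<Longrightarrow> v \<otimes>\<^bsub>S\<^esub> v = \<one>\<^bsub>S\<^esub>"
    and u: "u \<in> Units R"
  shows "u \<otimes>\<^bsub>R\<^esub> u = \<one>\<^bsub>R\<^esub>"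
proof -
  interpret R: ring R by fact
  interpret S: ring S by fact
  obtain h where h: "h \<in> ring_hom R S" and inj: "inj_on h (carrier R)"
    using \<open>R \<simeq> S\<close> by (auto simp: is_ring_iso_def ring_iso_def bij_betw_def)
  have uc: "u \<in> carrier R" and inv: "inv\<^bsub>R\<^esub> u \<in> carrier R"
    using u by auto
  have "h u \<otimes>\<^bsub>S\<^esub> h (inv\<^bsub>R\<^esub> u) = \<one>\<^bsub>S\<^esub>" "h (inv\<^bsub>R\<^esub> u) \<otimes>\<^bsub>S\<^esub> h u = \<one>\<^bsub>S\<^esub>"
    using u uc inv
    by (simp_all add: ring_hom_one[OF h] flip: ring_hom_mult[OF h])
  then have "h u \<in> Units S"
    using ring_hom_closed[OF h uc] ring_hom_closed[OF h inv] by (auto simp: Units_def)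
  then have "h (u \<otimes>\<^bsub>R\<^esub> u) = h \<one>\<^bsub>R\<^esub>"
    using uc sq by (simp add: ring_hom_one[OF h] ring_hom_mult[OF h])
  then show ?thesis
    using inj uc by (auto dest: inj_onD)
qed

lemma (in monoid) units_square_one_card_two:
  assumes "card (Units G) = 2" "u \<in> Units G"
  shows "u \<otimes> u = \<one>"
proof -
  interpret U: group "units_of G" by (rule units_group)
  have "u [^]\<^bsub>units_of G\<^esub> order (units_of G) = \<one>\<^bsub>units_of G\<^esub>"
    using assms by (intro U.pow_order_eq_1) (simp add: units_of_carrier)
  then show ?thesis
    using assms
    by (simp add: order_def units_of_carrier units_of_one units_of_mult numeral_2_eq_2 Units_closed)
qed

text \<open>The two prime powers dividing \<open>24\<close> can be treated separately, since, up to sign, \<open>n\<close> is the product of its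
  coprime parts \<open>gcd n 8\<close> and \<open>gcd n 3\<close>. Each part is either \<open>1\<close> or forces \<open>x\<close> to be prime to
  the corresponding prime.\<close>

lemma dvd_square_minus_one:
  fixes n x :: int
  assumes n: "n dvd 24" and "coprime x n"
  shows "n dvd x * x - 1"
proof -
  have two: "gcd n 8 dvd x * x - 1"
  proof (cases "even n")
    case True
    then have "odd x"
      using coprime_common_divisor[OF \<open>coprime x n\<close>, of 2] by auto
    then obtain k where k: "x = 2 * k + 1" by (rule oddE)
    have "even (k * (k + 1))" by simp
    then obtain m where "k * (k + 1) = 2 * m" by (rule evenE)
    then have "x * x - 1 = 8 * m" by (simp add: k algebra_simps)
    then have "8 dvd x * x - 1" by simp
    then show ?thesis by (rule dvd_trans[OF gcd_dvd2])
  next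
    case False
    then have "coprime n (2 ^ 3)"
      unfolding coprime_power_right_iff by (simp add: coprime_right_2_iff_odd)
    then show ?thesis by simp
  qed
  have three: "gcd n 3 dvd x * x - 1"
  proof (cases "3 dvd n")
    case True
    then have "\<not> 3 dvd x"
      using coprime_common_divisor[OF \<open>coprime x n\<close>, of 3] by auto
    then have "3 dvd x - 1 \<or> 3 dvd x + 1" by presburger
    then have "3 dvd (x - 1) * (x + 1)" by (auto intro: dvd_mult dvd_mult2)
    then have "3 dvd x * x - 1" by (simp add: algebra_simps)
    then show ?thesis by (rule dvd_trans[OF gcd_dvd2])
  next
    case False
    then have "coprime 3 n" by (intro prime_imp_coprime) simp_all
    then show ?thesis by (simp add: coprime_commute)
  qed
  have "coprime (2 ^ 3 :: int) 3"
    unfolding coprime_power_left_iff by (simp add: coprime_left_2_iff_odd)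
  then have "coprime (8::int) 3" by simp
  have "n dvd gcd n 8 * gcd n 3"
  proof -
    have "n dvd 8 * 3" using n by simp
    then obtain b c where "n = b * c" "b dvd 8" "c dvd 3"
      by (blast dest: division_decomp)
    then have "b dvd gcd n 8" "c dvd gcd n 3" by simp_all
    then show ?thesis unfolding \<open>n = b * c\<close> by (rule mult_dvd_mono)
  qed
  moreover have "gcd n 8 * gcd n 3 dvd x * x - 1"
    using two three coprime_divisors[OF gcd_dvd2 gcd_dvd2 \<open>coprime (8::int) 3\<close>]
    by (rule divides_mult)
  ultimately show ?thesis by (rule dvd_trans)
qed

lemma residue_ring_units_square_one:
  fixes n :: int
  assumes "n > 1" "n dvd 24" "u \<in> Units (residue_ring n)"
  shows "u \<otimes>\<^bsub>residue_ring n\<^esub> u = \<one>\<^bsub>residue_ring n\<^esub>"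
proof -
  interpret residues n "residue_ring n" using \<open>n > 1\<close> by unfold_locales simp_all
  have "coprime u n" using assms(3) by (simp add: res_units_eq)
  then have "n dvd u * u - 1" by (rule dvd_square_minus_one[OF \<open>n dvd 24\<close>])
  then have "u * u mod n = 1 mod n" by (simp add: mod_eq_dvd_iff)
  then show ?thesis
    using \<open>n > 1\<close> by (simp add: res_mult_eq res_one_eq)
qed

theorem proposition3p2:
  fixes R :: "('a, 'm) ring_scheme"
  assumes "ring R"
    and "(\<exists>S :: ('b, 'k) ring_scheme.
            reduced_ring S \<and> ring_char S = 0 \<and> card (Units S) = 2 \<and> R \<simeq> S)
         \<or> (\<exists>n::nat. n > 1 \<and> n dvd 24 \<and> R \<simeq> residue_ring (int n))"
  shows "empty_graph (unity_product_graph R)"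
  using assms(2)
proof (elim disjE exE conjE)
  fix S :: "('b, 'k) ring_scheme"
  assume "reduced_ring S" and card: "card (Units S) = 2" and iso: "R \<simeq> S"
  then interpret S: ring S by (simp add: reduced_ring_def)
  show ?thesis
    using units_square_one_iso[OF \<open>ring R\<close> S.ring_axioms iso S.units_square_one_card_two[OF card]]
    by (rule empty_unity_product_graph[OF \<open>ring R\<close>])
next
  fix n :: nat
  assume n: "n > 1" "n dvd 24" and iso: "R \<simeq> residue_ring (int n)"
  have n': "int n > 1" "int n dvd 24"
    using n int_dvd_int_iff[of n 24] by simp_all
  interpret residues "int n" "residue_ring (int n)" using n' by unfold_locales simp_all
  show ?thesis
    using units_square_one_iso[OF \<open>ring R\<close> ring_axioms iso residue_ring_units_square_one[OF n']]
    by (rule empty_unity_product_graph[OF \<open>ring R\<close>])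
qed

end
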